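(* Let $(t_0,x_0)\in\mathbb{R}^2$, let $D$ be a relatively open neighborhood of $(t_0,x_0)$ in the half-plane $\{(t,x)\in\mathbb{R}^2 : t\ge t_0\}$, and let $f:D\to\mathbb{R}$ be continuous in $D$. Let $x^*:[t_0,T)\to\mathbb{R}$ (with $t_0<T\le+\infty$) be the greatest noncontinuable solution of the initial value problem $$x'(t)=f(t,x(t)),\quad t\ge t_0,\qquad x(t_0)=x_0.$$ If $\alpha:I\to\mathbb{R}$ is a lower solution of this initial value problem, then $\alpha(t)\le x^*(t)$ for all $t\in I\cap[t_0,T)$. In particular, for every $t\in[t_0,T)$, $$x^*(t)=\max\{\alpha(t) : \alpha \text{ is a lower solution of the initial value problem (whose domain contains } t)\}.$$
   Context: A solution of the initial value problem on a nondegenerate interval $I$ with minimum $t_0$ is a differentiable function $x:I\to\mathbb{R}$ (one-sided derivatives at endpoints belonging to $I$) such that $(t,x(t))\in D$ and $x'(t)=f(t,x(t))$ for all $t\in I$, and $x(t_0)=x_0$. A solution is noncontinuable if it is not the restriction of a solution defined on a strictly larger interval. The greatest noncontinuable solution is the noncontinuable solution $x^*:[t_0,T)\to\mathbb{R}$ such that for any other solution $x:I\to\mathbb{R}$ one has $x(t)\le x^*(t)$ for all $t\in I\cap[t_0,T)$; it is known to exist under the stated assumptions on $f$. A lower solution of the initial value problem is a function $\alpha:I\to\mathbb{R}$ defined on a (nondegenerate) interval $I$ which has $t_0$ as minimum, such that $\alpha(t_0)\le x_0$, $\alpha$ is differentiable on $I$ (one-sided derivatives at endpoints belonging to $I$),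 its graph is contained in $D$, and $\alpha'(t)\le f(t,\alpha(t))$ for all $t\in I$. *)

theory Defs
  imports "HOL-Analysis.Analysis"
begin

text \<open>
  A function on an interval \<open>I\<close> is represented by a total function together with \<open>I\<close>; only its
  values on \<open>I\<close> matter. On a nondegenerate interval \<open>I\<close>, the filter \<open>at t within I\<close> gives the
  ordinary derivative at interior points and the one-sided derivative at endpoints in \<open>I\<close>,
  and the derivative is unique.
\<close>

definition interval_from :: "real \<Rightarrow> real set \<Rightarrow> bool" where
  "interval_from t0 I \<longleftrightarrow>
     is_interval I \<and> t0 \<in> I \<and> (\<forall>t\<in>I. t0 \<le> t) \<and> I \<noteq> {t0}"

definition ivp_solution ::
  "(real \<times> real \<Rightarrow> real) \<Rightarrow> (real \<times> real) set \<Rightarrow> real \<Rightarrow> real \<Rightarrow> real set \<Rightarrow> (real \<Rightarrow> real) \<Rightarrow> bool" where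
  "ivp_solution f D t0 x0 I x \<longleftrightarrow>
     interval_from t0 I \<and>
     (\<forall>t\<in>I. (t, x t) \<in> D \<and> (x has_real_derivative f (t, x t)) (at t within I)) \<and>
     x t0 = x0"

definition ivp_noncontinuable ::
  "(real \<times> real \<Rightarrow> real) \<Rightarrow> (real \<times> real) set \<Rightarrow> real \<Rightarrow> real \<Rightarrow> real set \<Rightarrow> (real \<Rightarrow> real) \<Rightarrow> bool" where
  "ivp_noncontinuable f D t0 x0 I x \<longleftrightarrow>
     ivp_solution f D t0 x0 I x \<and>
     \<not> (\<exists>J y. I \<subset> J \<and> ivp_solution f D t0 x0 J y \<and> (\<forall>t\<in>I. y t = x t))"

text \<open>The half-open interval from \<open>t0\<close> to \<open>T\<close>, where \<open>T = \<infinity>\<close> is allowed.\<close>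

definition Ico_ereal :: "real \<Rightarrow> ereal \<Rightarrow> real set" where
  "Ico_ereal t0 T = {t. t0 \<le> t \<and> ereal t < T}"

definition ivp_greatest_noncontinuable ::
  "(real \<times> real \<Rightarrow> real) \<Rightarrow> (real \<times> real) set \<Rightarrow> real \<Rightarrow> real \<Rightarrow> ereal \<Rightarrow> (real \<Rightarrow> real) \<Rightarrow> bool" where
  "ivp_greatest_noncontinuable f D t0 x0 T xstar \<longleftrightarrow>
     ivp_noncontinuable f D t0 x0 (Ico_ereal t0 T) xstar \<and>
     (\<forall>I x. ivp_solution f D t0 x0 I x \<longrightarrow> (\<forall>t \<in> I \<inter> Ico_ereal t0 T. x t \<le> xstar t))"

definition ivp_lower_solution ::
  "(real \<times> real \<Rightarrow> real) \<Rightarrow> (real \<times> real) set \<Rightarrow> real \<Rightarrow> real \<Rightarrow> real set \<Rightarrow> (real \<Rightarrow> real) \<Rightarrow> bool" where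
  "ivp_lower_solution f D t0 x0 I \<alpha> \<longleftrightarrow>
     interval_from t0 I \<and>
     \<alpha> t0 \<le> x0 \<and>
     (\<forall>t\<in>I. (t, \<alpha> t) \<in> D \<and>
            (\<exists>d. (\<alpha> has_real_derivative d) (at t within I) \<and> d \<le> f (t, \<alpha> t)))"

end

theory Submission
  imports Defs "HOL-Complex_Analysis.Great_Picard"
begin

text \<open>
  Suppose a lower solution \<open>\<alpha>\<close> exceeds \<open>x\<^sup>*\<close> at some \<open>t\<close>, and let \<open>s\<close> be the last point before \<open>t\<close>
  at which the two agree. Peano's theorem, applied to \<open>f\<close> with its second argument replaced by
  \<open>max u (\<alpha> t)\<close>, gives a function \<open>y\<close> on a short interval to the right of \<open>s\<close> with
  \<open>y s = \<alpha> s\<close>. Wherever \<open>y < \<alpha>\<close> the modified equation reads \<open>y' = f (t, \<alpha> t) \<ge> \<alpha>'\<close>, so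
  \<open>\<alpha> - y\<close> cannot become positive; hence \<open>y \<ge> \<alpha>\<close> and \<open>y\<close> solves the original equation. Continuing
  \<open>x\<^sup>*\<close> by \<open>y\<close> after \<open>s\<close> produces a solution that exceeds \<open>x\<^sup>*\<close>, a contradiction. The argument is
  local at \<open>s\<close> because \<open>D\<close> need not contain the region between the graphs of \<open>x\<^sup>*\<close> and \<open>\<alpha>\<close>.
\<close>

section \<open>Last zeros of continuous functions\<close>

text \<open>The points of \<open>{s..t}\<close> where \<open>h\<close> is nonpositive form a compact
  set with largest element \<open>a\<close>. The intermediate value theorem on \<open>{a..t}\<close>
  gives a zero, which must be \<open>a\<close> because \<open>h\<close> is positive beyond
  it.\<close>

lemma last_nonpos_before_positive:
  fixes h :: "real \<Rightarrow> real"
  assumes "s \<le> t" and cont: "continuous_on {s..t} h" and "h s \<le> 0" and "0 < h t"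
  obtains a where "s \<le> a" "a < t" "h a = 0" "\<And>u. a < u \<Longrightarrow> u \<le> t \<Longrightarrow> 0 < h u"
proof -
  define Z where "Z = {s..t} \<inter> h -` {..0}"
  have "closed Z"
    unfolding Z_def using cont by (intro continuous_closed_preimage) auto
  moreover have "bounded Z"
    unfolding Z_def by (rule bounded_subset[OF bounded_closed_interval]) auto
  ultimately have "compact Z"
    by (simp add: compact_eq_bounded_closed)
  moreover have "s \<in> Z"
    using assms by (simp add: Z_def)
  ultimately obtain a where a: "a \<in> Z" "\<And>u. u \<in> Z \<Longrightarrow> u \<le> a"
    using compact_attains_sup[of Z] by auto
  have pos: "0 < h u" if "a < u" "u \<le> t" for u
    using that a(1) a(2)[of u] by (force simp: Z_def)
  have "a < t"
    using a(1) \<open>0 < h t\<close> by (cases "a = t") (auto simp: Z_def)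
  moreover have "continuous_on {a..t} h"
    using a(1) by (intro continuous_on_subset[OF cont]) (auto simp: Z_def)
  ultimately obtain u where "a \<le> u" "u \<le> t" "h u = 0"
    using IVT'[of h a 0 t] a(1) \<open>0 < h t\<close> by (auto simp: Z_def)
  with pos[of u] have "h a = 0"
    by force
  with pos a(1) \<open>a < t\<close> show thesis
    by (intro that[of a]) (auto simp: Z_def)
qed

section \<open>Peano's existence theorem for bounded right-hand sides\<close>

text \<open>The integrand at \<open>s\<close> uses \<open>y\<close> only at \<open>s - d\<close>, or
  at \<open>a\<close> during the first delay, so iterating the integral operator \<open>P\<close>
  from the constant \<open>c\<close> reaches a solution on \<open>{a..b}\<close> after finitely many
  steps.\<close>

lemma delay_equation_solution:
  fixes F :: "real \<times> 'a::euclidean_space \<Rightarrow> 'a"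
  assumes F: "continuous_on ({a..b} \<times> UNIV) F" and "0 < d"
  obtains y where "continuous_on {a..b} y"
    "\<And>t. t \<in> {a..b} \<Longrightarrow> y t = c + integral {a..t} (\<lambda>s. F (s, y (max a (s - d))))"
proof -
  define P where "P = (\<lambda>g t. c + integral {a..t} (\<lambda>s. F (s, g (max a (s - d)))))"
  define g where "g = (\<lambda>k. (P ^^ k) (\<lambda>_. c))"
  have g_Suc: "g (Suc k) = P (g k)" for k
    by (simp add: g_def)
  have cont: "continuous_on {a..b} (g k)" for k
  proof (induction k)
    case 0
    show ?case by (simp add: g_def)
  next
    case (Suc k)
    have "continuous_on {a..b} (\<lambda>s. F (s, g k (max a (s - d))))"
      using \<open>0 < d\<close>
      by (intro continuous_on_compose2[OF F] continuous_on_Pair continuous_on_compose2[OF Suc]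
          continuous_intros) auto
    then show ?case
      unfolding g_Suc P_def
      by (intro continuous_intros indefinite_integral_continuous_1 integrable_continuous_real)
  qed
  \<comment> \<open>The delay makes the iteration stationary on one further interval of length \<open>d\<close> per step.\<close>
  have stable: "g (Suc k) t = g k t" if "a \<le> t" "t \<le> a + k * d" for k t
    using that
  proof (induction k arbitrary: t)
    case 0
    then show ?case by (simp add: g_def P_def)
  next
    case (Suc k)
    have "g (Suc k) (max a (s - d)) = g k (max a (s - d))" if "s \<in> {a..t}" for s
      using that Suc.prems \<open>0 < d\<close> by (intro Suc.IH) (auto simp: algebra_simps)
    then have "P (g (Suc k)) t = P (g k) t"
      unfolding P_def by (intro arg_cong2[where f = plus] refl integral_cong) simp
    then show ?case
      by (simp only: g_Suc)
  qed
  \<comment> \<open>\<open>N\<close> delays cover \<open>{a..b}\<close>, so \<open>g N\<close>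
    agrees there with \<open>P (g N)\<close>.\<close>
  obtain N where N: "(b - a) / d < real N"
    using reals_Archimedean2 by blast
  then have "b \<le> a + real N * d"
    using \<open>0 < d\<close> by (simp add: field_simps)
  then have "g N t = c + integral {a..t} (\<lambda>s. F (s, g N (max a (s - d))))" if "t \<in> {a..b}" for t
    using that stable[of t N] by (simp add: g_Suc P_def)
  with cont show thesis
    by (rule that)
qed

text \<open>
  Tonelli's approximations: solutions of the equation with delay \<open>1 / (n + 1)\<close> share the Lipschitz
  constant \<open>M\<close>, so a subsequence converges uniformly.
\<close>

theorem peano_existence:
  fixes F :: "real \<times> 'a::euclidean_space \<Rightarrow> 'a"
  assumes F: "continuous_on ({a..b} \<times> UNIV) F"
    and M: "\<And>t x. t \<in> {a..b} \<Longrightarrow> norm (F (t, x)) \<le> M"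
    and "a \<le> b"
  obtains y where "y a = c"
    "\<And>t. t \<in> {a..b} \<Longrightarrow> (y has_vector_derivative F (t, y t)) (at t within {a..b})"
proof -
  define d where "d = (\<lambda>n. 1 / real (Suc n))"
  have "\<exists>y. continuous_on {a..b} y \<and>
      (\<forall>t\<in>{a..b}. y t = c + integral {a..t} (\<lambda>s. F (s, y (max a (s - d n)))))" for n
    by (rule delay_equation_solution[OF F, of "d n" c]) (auto simp: d_def)
  then obtain Y where contY: "\<And>n. continuous_on {a..b} (Y n)"
    and Y: "\<And>n t. t \<in> {a..b} \<Longrightarrow>
      Y n t = c + integral {a..t} (\<lambda>s. F (s, Y n (max a (s - d n))))"
    by metis
  define G where "G = (\<lambda>n s. F (s, Y n (max a (s - d n))))"
  have delay: "max a (s - d n) \<in> {a..b}" if "s \<in> {a..b}" for n s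
  proof -
    have "0 < d n"
      by (simp add: d_def)
    then show ?thesis
      using that by auto
  qed
  have contG: "continuous_on {a..b} (G n)" for n
    unfolding G_def
    by (intro continuous_on_compose2[OF F] continuous_on_Pair continuous_on_compose2[OF contY]
        continuous_intros) (auto intro!: delay simp del: atLeastAtMost_iff max_less_iff_conj)
  have "0 \<le> M"
    using M[of a c] \<open>a \<le> b\<close> by (meson atLeastAtMost_iff norm_ge_zero order_refl order_trans)
  have lip: "norm (Y n t - Y n s) \<le> M * \<bar>t - s\<bar>" if "s \<in> {a..b}" "t \<in> {a..b}" for n s t
    using that
  proof (induction s t rule: linorder_wlog)
    case (le s t)
    have "integral {a..s} (G n) + integral {s..t} (G n) = integral {a..t} (G n)"
      using le contG[of n]
      by (intro Henstock_Kurzweil_Integration.integral_combine integrable_continuous_real)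
        (auto intro: continuous_on_subset)
    then have "Y n t - Y n s = integral {s..t} (G n)"
      using Y[of t n] Y[of s n] le by (simp add: G_def algebra_simps)
    also have "norm \<dots> \<le> M * (t - s)"
      using le contG[of n] M
      by (intro integral_bound) (auto intro: continuous_on_subset simp: G_def)
    finally show ?case using le by simp
  next
    case (sym s t)
    then show ?case by (simp add: norm_minus_commute abs_minus_commute)
  qed
  have bounded: "norm (Y n t) \<le> norm c + M * (b - a)" if "t \<in> {a..b}" for n t
  proof -
    have "Y n a = c"
      using Y[of a n] \<open>a \<le> b\<close> by simp
    then have "norm (Y n t) \<le> norm c + norm (Y n t - Y n a)"
      by (metis add.commute norm_triangle_sub)
    also have "norm (Y n t - Y n a) \<le> M * \<bar>t - a\<bar>"
      using that \<open>a \<le> b\<close> by (intro lip) auto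
    also have "\<dots> \<le> M * (b - a)"
      using that \<open>0 \<le> M\<close> by (intro mult_left_mono) auto
    finally show ?thesis by (simp add: algebra_simps)
  qed
  \<comment> \<open>Dividing by \<open>M + 1\<close> rather than \<open>M\<close> covers the case
    \<open>M = 0\<close>; the radius is the same for all \<open>n\<close>.\<close>
  have equicont: "\<exists>r>0. \<forall>n u. u \<in> {a..b} \<and> norm (t - u) < r \<longrightarrow> norm (Y n t - Y n u) < e"
    if "t \<in> {a..b}" "0 < e" for t e
  proof (intro exI[of _ "e / (M + 1)"] conjI allI impI)
    show "0 < e / (M + 1)"
      using that \<open>0 \<le> M\<close> by simp
    fix n u assume u: "u \<in> {a..b} \<and> norm (t - u) < e / (M + 1)"
    have "norm (Y n t - Y n u) \<le> M * \<bar>t - u\<bar>"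
      using lip u that by simp
    also have "\<dots> \<le> (M + 1) * \<bar>t - u\<bar>"
      by (intro mult_right_mono) auto
    also have "\<dots> < e"
      using u \<open>0 \<le> M\<close> by (simp add: field_simps)
    finally show "norm (Y n t - Y n u) < e" .
  qed
  obtain y k where conty: "continuous_on {a..b} y" and k: "strict_mono (k :: nat \<Rightarrow> nat)"
    and unif: "\<And>e. 0 < e \<Longrightarrow>
      \<exists>N. \<forall>n x. n \<ge> N \<and> x \<in> {a..b} \<longrightarrow> norm (Y (k n) x - y x) < e"
    by (rule Arzela_Ascoli[OF compact_Icc bounded equicont]) blast+
  have lim: "(\<lambda>n. Y (k n) t) \<longlonglongrightarrow> y t" if "t \<in> {a..b}" for t
    unfolding LIMSEQ_iff using unif that by blast
  \<comment> \<open>The delayed argument differs from \<open>t\<close> by at most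
    \<open>d (k n)\<close>, which tends to 0, so by \<open>lip\<close> the delayed values have the
    same limit.\<close>
  have lim_delay: "(\<lambda>n. Y (k n) (max a (t - d (k n)))) \<longlonglongrightarrow> y t" if t: "t \<in> {a..b}" for t
  proof -
    have d0: "(\<lambda>n. M * d (k n)) \<longlonglongrightarrow> 0"
      using LIMSEQ_subseq_LIMSEQ[OF LIMSEQ_inverse_real_of_nat k]
      by (intro tendsto_mult_right_zero) (simp add: d_def o_def inverse_eq_divide)
    have "norm (Y (k n) (max a (t - d (k n))) - Y (k n) t) \<le> M * d (k n)" for n
    proof -
      have "0 < d (k n)"
        by (simp add: d_def)
      then have "norm (Y (k n) (max a (t - d (k n))) - Y (k n) t) \<le> M * \<bar>max a (t - d (k n)) - t\<bar>"
        using t by (intro lip) auto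
      also have "\<dots> \<le> M * d (k n)"
        using t \<open>0 < d (k n)\<close> \<open>0 \<le> M\<close> by (intro mult_left_mono) auto
      finally show ?thesis .
    qed
    then have "(\<lambda>n. Y (k n) (max a (t - d (k n))) - Y (k n) t) \<longlonglongrightarrow> 0"
      by (intro Lim_null_comparison[OF _ d0]) simp
    from tendsto_add[OF this lim[OF t]] show ?thesis by simp
  qed
  have limG: "(\<lambda>n. G (k n) t) \<longlonglongrightarrow> F (t, y t)" if "t \<in> {a..b}" for t
    unfolding G_def using that
    by (intro continuous_on_tendsto_compose[OF F] tendsto_Pair tendsto_const lim_delay) auto
  have y_eq: "y t = c + integral {a..t} (\<lambda>s. F (s, y s))" if t: "t \<in> {a..b}" for t
  proof (rule LIMSEQ_unique)
    show "(\<lambda>n. Y (k n) t) \<longlonglongrightarrow> y t"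
      by (rule lim[OF t])
    have "(\<lambda>n. integral {a..t} (G (k n))) \<longlonglongrightarrow> integral {a..t} (\<lambda>s. F (s, y s))"
    proof (rule dominated_convergence(2)[where h = "\<lambda>_. M"])
      show "G (k n) integrable_on {a..t}" for n
        using t by (intro integrable_continuous_real continuous_on_subset[OF contG]) auto
      show "(\<lambda>_. M) integrable_on {a..t}"
        by (intro integrable_continuous_real continuous_on_const)
      show "norm (G (k n) s) \<le> M" if "s \<in> {a..t}" for n s
        using that t by (simp add: G_def M)
      show "(\<lambda>n. G (k n) s) \<longlonglongrightarrow> F (s, y s)" if "s \<in> {a..t}" for s
        using that t by (intro limG) auto
    qed
    then show "(\<lambda>n. Y (k n) t) \<longlonglongrightarrow> c + integral {a..t} (\<lambda>s. F (s, y s))"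
      unfolding Y[OF t] by (intro tendsto_add tendsto_const) (simp add: G_def)
  qed
  show thesis
  proof
    show "y a = c"
      using y_eq[of a] \<open>a \<le> b\<close> by simp
    fix t assume t: "t \<in> {a..b}"
    have "continuous_on {a..b} (\<lambda>s. F (s, y s))"
      by (intro continuous_on_compose2[OF F] continuous_on_Pair conty continuous_intros) auto
    from integral_has_vector_derivative[OF this t]
    have "((\<lambda>t. c + integral {a..t} (\<lambda>s. F (s, y s))) has_vector_derivative F (t, y t))
        (at t within {a..b})"
      by (auto intro!: derivative_eq_intros)
    then show "(y has_vector_derivative F (t, y t)) (at t within {a..b})"
      by (rule has_vector_derivative_transform[OF t y_eq, rotated])
  qed
qed

section \<open>Local solutions above a lower solution\<close>

text \<open>If \<open>h t\<close> were positive, then \<open>h' \<le> 0\<close> after the last zero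
  \<open>r\<close> before \<open>t\<close>, and the mean value theorem would give
  \<open>h t \<le> h r = 0\<close>. For \<open>h = \<alpha> - y\<close> the sign of
  \<open>h'\<close> is known only where \<open>y < \<alpha>\<close>, hence the form of the second
  hypothesis.\<close>

lemma nonpos_of_deriv_nonpos_where_positive:
  fixes h h' :: "real \<Rightarrow> real"
  assumes deriv: "\<And>t. t \<in> {a..b} \<Longrightarrow> (h has_real_derivative h' t) (at t within {a..b})"
    and sign: "\<And>t. t \<in> {a..b} \<Longrightarrow> 0 < h t \<Longrightarrow> h' t \<le> 0"
    and "h a \<le> 0" and t: "t \<in> {a..b}"
  shows "h t \<le> 0"
proof (rule ccontr)
  assume "\<not> h t \<le> 0"
  have deriv': "(h has_real_derivative h' u) (at u within {r..t})" if "a \<le> r" "u \<in> {r..t}" for r u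
    using that t by (intro DERIV_subset[OF deriv]) auto
  then have "continuous_on {a..t} h"
    by (intro DERIV_continuous_on) auto
  then obtain r where r: "a \<le> r" "r < t" "h r = 0" "\<And>u. r < u \<Longrightarrow> u \<le> t \<Longrightarrow> 0 < h u"
    using last_nonpos_before_positive[of a t h] t \<open>h a \<le> 0\<close> \<open>\<not> h t \<le> 0\<close> by auto
  obtain u where u: "u \<in> {r<..<t}" "h t - h r = h' u * (t - r)"
    using mvt_simple[of r t h "\<lambda>u. (*) (h' u)"] deriv' r
    by (auto simp: has_field_derivative_def)
  moreover have "h' u \<le> 0"
    using u(1) r t by (intro sign) auto
  ultimately have "h t \<le> 0"
    using r by (simp add: mult_nonpos_nonneg)
  then show False
    using \<open>\<not> h t \<le> 0\<close> by simp
qed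

text \<open>On a closed box in \<open>D\<close> to the right of \<open>(s, \<alpha> s)\<close> the
  function \<open>f\<close> is bounded, so Peano's theorem applies to the modified equation.
  Shortening the interval until \<open>y\<close> stays in the box removes the modification.\<close>

lemma local_solution_above_lower_solution:
  fixes f :: "real \<times> real \<Rightarrow> real" and \<alpha> :: "real \<Rightarrow> real"
  assumes D: "openin (top_of_set {p. t0 \<le> fst p}) D" "(s, \<alpha> s) \<in> D"
    and f: "continuous_on D f" and "s < b"
    and \<alpha>: "\<And>t. t \<in> {s..b} \<Longrightarrow>
      \<exists>d. (\<alpha> has_real_derivative d) (at t within {s..b}) \<and> d \<le> f (t, \<alpha> t)"
  obtains e y where "s < e" "e \<le> b" "y s = \<alpha> s"
    "\<And>t. t \<in> {s..e} \<Longrightarrow> (t, y t) \<in> D \<and> \<alpha> t \<le> y t \<and>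
       (y has_real_derivative f (t, y t)) (at t within {s..e})"
proof -
  define p where "p = \<alpha> s"
  have "s \<ge> t0"
    using D openin_imp_subset by fastforce
  obtain r where r: "0 < r" "ball (s, p) r \<inter> {p. t0 \<le> fst p} \<subseteq> D"
    using D unfolding openin_contains_ball p_def by blast
  \<comment> \<open>Points of the box are at distance at most \<open>2 * q < r\<close> from
    \<open>(s, p)\<close>.\<close>
  define q where "q = r / 3"
  have "0 < q" using r by (simp add: q_def)
  have box: "(t, u) \<in> D" if "t \<in> {s..s + q}" "u \<in> {p - q..p + q}" for t u
  proof -
    have "dist (s, p) (t, u) \<le> \<bar>s - t\<bar> + \<bar>p - u\<bar>"
      using sqrt_sum_squares_le_sum_abs by (simp add: dist_Pair_Pair dist_real_def)
    also have "\<dots> < r"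
      using that r unfolding q_def by auto
    finally show ?thesis using r \<open>s \<ge> t0\<close> that by auto
  qed
  \<comment> \<open>Used first to fit the graph of \<open>\<alpha>\<close> into the box, then to
    keep \<open>y\<close> below the cap.\<close>
  have near: "\<exists>e>s. e \<le> c \<and> (\<forall>t\<in>{s..e}. \<bar>g t - g s\<bar> \<le> q)"
    if g: "continuous_on {s..c} g" and "s < c" for g :: "real \<Rightarrow> real" and c
  proof -
    obtain w where w: "0 < w" "\<And>t. t \<in> {s..c} \<Longrightarrow> dist t s < w \<Longrightarrow> dist (g t) (g s) < q"
      using g[unfolded continuous_on_iff, rule_format, of s q] \<open>s < c\<close> \<open>0 < q\<close> by auto
    show ?thesis
    proof (intro exI[of _ "min c (s + w / 2)"] conjI ballI)
      fix t assume "t \<in> {s..min c (s + w / 2)}"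
      then show "\<bar>g t - g s\<bar> \<le> q"
        using w(2)[of t] w(1) by (auto simp: dist_real_def)
    qed (use w \<open>s < c\<close> in auto)
  qed
  have cont\<alpha>: "continuous_on {s..b} \<alpha>"
    using \<alpha> by (metis DERIV_continuous continuous_on_eq_continuous_within)
  define m where "m = min b (s + q)"
  have m: "s < m" "m \<le> b" "m \<le> s + q"
    using \<open>0 < q\<close> \<open>s < b\<close> by (auto simp: m_def)
  have "continuous_on {s..m} \<alpha>"
    using m by (intro continuous_on_subset[OF cont\<alpha>]) auto
  from near[OF this m(1)] obtain e1 where "s < e1" "e1 \<le> m"
    and e1\<alpha>: "\<And>t. t \<in> {s..e1} \<Longrightarrow> \<bar>\<alpha> t - p\<bar> \<le> q"
    by (auto simp: p_def)
  with m have e1: "s < e1" "e1 \<le> b" "e1 \<le> s + q"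
    by auto
  \<comment> \<open>The cap \<open>p + q\<close> keeps the arguments of \<open>f\<close> in the box, so that the right-hand side is bounded.\<close>
  define k where "k = (\<lambda>(t, u). (t, min (p + q) (max u (\<alpha> t))))"
  have k: "k (t, u) \<in> {s..s + q} \<times> {p - q..p + q}" if "t \<in> {s..e1}" for t u
    using that e1 e1\<alpha>[of t] \<open>0 < q\<close> by (auto simp: k_def)
  have boxD: "{s..s + q} \<times> {p - q..p + q} \<subseteq> D"
    using box by auto
  have contk: "continuous_on ({s..e1} \<times> UNIV) k"
    unfolding k_def split_beta using e1
    by (intro continuous_intros continuous_on_compose2[OF cont\<alpha>]) auto
  have contF: "continuous_on ({s..e1} \<times> UNIV) (\<lambda>z. f (k z))"
  proof (rule continuous_on_compose2[OF f contk])
    show "k ` ({s..e1} \<times> UNIV) \<subseteq> D"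
      using k boxD by (auto simp: image_subset_iff simp del: mem_Sigma_iff)
  qed
  have "bounded (f ` ({s..s + q} \<times> {p - q..p + q}))"
    by (intro compact_imp_bounded compact_continuous_image continuous_on_subset[OF f boxD] compact_Times compact_Icc)
  then obtain M where M: "\<And>z. z \<in> {s..s + q} \<times> {p - q..p + q} \<Longrightarrow> norm (f z) \<le> M"
    by (meson bounded_iff imageI)
  have M': "norm (f (k (t, u))) \<le> M" if "t \<in> {s..e1}" for t u
    by (rule M[OF k[OF that]])
  obtain y where ys: "y s = p"
    and y: "\<And>t. t \<in> {s..e1} \<Longrightarrow> (y has_real_derivative f (k (t, y t))) (at t within {s..e1})"
    unfolding has_real_derivative_iff_has_vector_derivative
    using peano_existence[OF contF M' less_imp_le[OF e1(1)], where c = p] by blast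
  have above: "\<alpha> t \<le> y t" if t: "t \<in> {s..e1}" for t
  proof -
    obtain \<alpha>' where \<alpha>': "\<And>t. t \<in> {s..b} \<Longrightarrow>
        (\<alpha> has_real_derivative \<alpha>' t) (at t within {s..b}) \<and> \<alpha>' t \<le> f (t, \<alpha> t)"
      using \<alpha> by metis
    have "\<alpha> t - y t \<le> 0"
    proof (rule nonpos_of_deriv_nonpos_where_positive[OF _ _ _ t,
          where h = "\<lambda>t. \<alpha> t - y t" and h' = "\<lambda>t. \<alpha>' t - f (k (t, y t))"])
      fix t assume t: "t \<in> {s..e1}"
      have "(\<alpha> has_real_derivative \<alpha>' t) (at t within {s..e1})"
        by (rule DERIV_subset[where s = "{s..b}"]) (use \<alpha>' t e1 in auto)
      then show "((\<lambda>t. \<alpha> t - y t) has_real_derivative \<alpha>' t - f (k (t, y t))) (at t within {s..e1})"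
        by (intro DERIV_diff y t)
      assume "0 < \<alpha> t - y t"
      \<comment> \<open>Here \<open>max\<close> selects \<open>\<alpha> t\<close>, and the cap
        leaves it alone because \<open>\<alpha> t \<le> p + q\<close>.\<close>
      then have "k (t, y t) = (t, \<alpha> t)"
        using e1\<alpha>[OF t] by (auto simp: k_def)
      then show "\<alpha>' t - f (k (t, y t)) \<le> 0"
        using \<alpha>'[of t] t e1 by auto
    qed (simp add: ys p_def)
    then show ?thesis by simp
  qed
  have "continuous_on {s..e1} y"
    using y by (rule DERIV_continuous_on)
  then obtain e where e: "s < e" "e \<le> e1" "\<And>t. t \<in> {s..e} \<Longrightarrow> \<bar>y t - p\<bar> \<le> q"
    using near[of e1 y] e1(1) ys by blast
  show thesis
  proof
    show "s < e" "e \<le> b" "y s = \<alpha> s"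
      using e e1 ys by (auto simp: p_def)
    fix t assume t: "t \<in> {s..e}"
    \<comment> \<open>Since \<open>\<alpha> t \<le> y t \<le> p + q\<close>, both the maximum and
      the cap return \<open>y t\<close>, so \<open>y\<close> solves the original equation.\<close>
    have "k (t, y t) = (t, y t)"
      using above[of t] t e(2) e(3)[OF t] by (auto simp: k_def)
    moreover have "(y has_real_derivative f (k (t, y t))) (at t within {s..e})"
      by (rule DERIV_subset[where s = "{s..e1}"]) (use y t e in auto)
    moreover have "(t, y t) \<in> D"
      using t e(2) e(3)[OF t] e1(3) by (intro box) auto
    ultimately show "(t, y t) \<in> D \<and> \<alpha> t \<le> y t \<and>
       (y has_real_derivative f (t, y t)) (at t within {s..e})"
      using above[of t] t e by auto
  qed
qed

section \<open>Gluing solutions and comparison with the greatest solution\<close>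

text \<open>Both pieces prescribe the same derivative at the junction, since
  \<open>y s = x s\<close> gives \<open>f (s, x s) = f (s, y s)\<close>. The values of
  \<open>x\<close> after \<open>s\<close> are discarded.\<close>

lemma ivp_solution_glue:
  assumes x: "ivp_solution f D t0 x0 I x" and "s \<in> I" and "s < e" and "y s = x s"
    and y: "\<And>t. t \<in> {s..e} \<Longrightarrow> (t, y t) \<in> D \<and>
      (y has_real_derivative f (t, y t)) (at t within {s..e})"
  shows "ivp_solution f D t0 x0 {t0..e} (\<lambda>t. if t \<le> s then x t else y t)"
proof -
  \<comment> \<open>\<open>?z\<close> and \<open>?w\<close> agree from \<open>t0\<close> on;
    \<open>?z\<close> tests membership in a set, as the rule for piecewise derivatives
    expects.\<close>
  let ?z = "\<lambda>t. if t \<in> {t0..s} then x t else y t"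
  let ?w = "\<lambda>t. if t \<le> s then x t else y t"
  have I: "is_interval I" "t0 \<in> I" "t0 \<le> s"
    using x \<open>s \<in> I\<close> by (auto simp: ivp_solution_def interval_from_def)
  have sub: "{t0..s} \<subseteq> I"
    using I \<open>s \<in> I\<close> by (meson atLeastAtMost_iff mem_is_interval_1_I subsetI)
  have x': "(x has_vector_derivative f (t, x t)) (at t within {t0..s})" if "t \<in> {t0..s}" for t
    using that x sub unfolding has_real_derivative_iff_has_vector_derivative[symmetric]
    by (intro DERIV_subset[OF _ sub]) (auto simp: ivp_solution_def)
  have y': "(y has_vector_derivative f (t, y t)) (at t within {s..e})" if "t \<in> {s..e}" for t
    using y[OF that] by (simp add: has_real_derivative_iff_has_vector_derivative)
  \<comment> \<open>The two closed pieces meet only at \<open>s\<close>, so adjoining their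
    intersection enlarges neither.\<close>
  have meet: "{t0..s} \<union> {t0..s} \<inter> {s..e} = {t0..s}" "{s..e} \<union> {t0..s} \<inter> {s..e} = {s..e}"
    using I \<open>s < e\<close> by auto
  have z': "(?z has_vector_derivative f (t, ?z t)) (at t within {t0..e})" if "t \<in> {t0..e}" for t
  proof -
    have "(?z has_vector_derivative (if t \<in> {t0..s} then f (t, x t) else f (t, y t)))
        (at t within {t0..e})"
      using that I \<open>s < e\<close> \<open>y s = x s\<close> meet x' y'
      by (intro has_vector_derivative_If_within_closures[where T = "{s..e}"]) auto
    moreover have "(if t \<in> {t0..s} then f (t, x t) else f (t, y t)) = f (t, ?z t)"
      by simp
    ultimately show ?thesis by (simp only:)
  qed
  have w': "(?w has_real_derivative f (t, ?w t)) (at t within {t0..e})" if "t \<in> {t0..e}" for t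
    unfolding has_real_derivative_iff_has_vector_derivative
    using has_vector_derivative_transform[OF that _ z'[OF that], of ?w] that by auto
  have "e \<in> {t0..e}" "e \<noteq> t0"
    using I \<open>s < e\<close> by auto
  then have "{t0..e} \<noteq> {t0}"
    by blast
  then show ?thesis
    unfolding ivp_solution_def interval_from_def
    using w' y x sub I \<open>s < e\<close>
    by (auto simp: ivp_solution_def is_interval_cc)
qed

theorem theorem3p1:
  fixes t0 x0 :: real
    and D :: "(real \<times> real) set"
    and f :: "real \<times> real \<Rightarrow> real"
    and T :: ereal
    and xstar :: "real \<Rightarrow> real"
  assumes "openin (top_of_set {p. t0 \<le> fst p}) D"
    and "(t0, x0) \<in> D"
    and "continuous_on D f"
    and "ereal t0 < T"
    and "ivp_greatest_noncontinuable f D t0 x0 T xstar"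
  shows "(\<forall>I \<alpha>. ivp_lower_solution f D t0 x0 I \<alpha> \<longrightarrow>
            (\<forall>t \<in> I \<inter> Ico_ereal t0 T. \<alpha> t \<le> xstar t)) \<and>
         (\<forall>t \<in> Ico_ereal t0 T.
            xstar t \<in> {\<alpha> t | \<alpha> I. ivp_lower_solution f D t0 x0 I \<alpha> \<and> t \<in> I} \<and>
            (\<forall>v \<in> {\<alpha> t | \<alpha> I. ivp_lower_solution f D t0 x0 I \<alpha> \<and> t \<in> I}. v \<le> xstar t))"
proof -
  have x: "ivp_solution f D t0 x0 (Ico_ereal t0 T) xstar"
    and greatest: "\<And>I x t. ivp_solution f D t0 x0 I x \<Longrightarrow> t \<in> I \<inter> Ico_ereal t0 T \<Longrightarrow> x t \<le> xstar t"
    using assms(5) by (auto simp: ivp_greatest_noncontinuable_def ivp_noncontinuable_def)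
  have le: "\<alpha> t \<le> xstar t"
    if lower: "ivp_lower_solution f D t0 x0 I \<alpha>" and t: "t \<in> I" "t \<in> Ico_ereal t0 T" for I \<alpha> t
  proof (rule ccontr)
    assume "\<not> \<alpha> t \<le> xstar t"
    have "t0 \<le> t"
      using t by (simp add: Ico_ereal_def)
    have subJ: "{t0..t} \<subseteq> Ico_ereal t0 T"
      using t by (auto simp: Ico_ereal_def intro: le_less_trans[of _ "ereal t"])
    have subI: "{t0..t} \<subseteq> I"
      using lower t unfolding ivp_lower_solution_def interval_from_def
      by (meson atLeastAtMost_iff mem_is_interval_1_I subsetI)
    \<comment> \<open>The left endpoint \<open>r\<close> stays free: \<open>r = t0\<close> yields
      continuity of \<open>\<alpha>\<close>, \<open>r = s\<close> serves the local
      construction.\<close>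
    have \<alpha>: "\<exists>d. (\<alpha> has_real_derivative d) (at u within {r..t}) \<and> d \<le> f (u, \<alpha> u)"
      if "t0 \<le> r" "u \<in> {r..t}" for r u
    proof -
      have "u \<in> I" "{r..t} \<subseteq> I"
        using that subI by auto
      then show ?thesis
        using lower unfolding ivp_lower_solution_def by (meson DERIV_subset)
    qed
    have "continuous_on {t0..t} \<alpha>"
      using \<alpha>[of t0] by (metis DERIV_continuous continuous_on_eq_continuous_within order_refl)
    moreover have "continuous_on (Ico_ereal t0 T) xstar"
      using x unfolding ivp_solution_def by (intro DERIV_continuous_on) blast
    then have "continuous_on {t0..t} xstar"
      using subJ continuous_on_subset by blast
    ultimately have "continuous_on {t0..t} (\<lambda>u. \<alpha> u - xstar u)"
      by (rule continuous_on_diff)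
    \<comment> \<open>The sign required at \<open>t0\<close> is the initial condition
      \<open>\<alpha> t0 \<le> x0 = xstar t0\<close>.\<close>
    then obtain s where s: "t0 \<le> s" "s < t" "\<alpha> s = xstar s"
      and above: "\<And>u. s < u \<Longrightarrow> u \<le> t \<Longrightarrow> xstar u < \<alpha> u"
      using last_nonpos_before_positive[of t0 t "\<lambda>u. \<alpha> u - xstar u"] \<open>t0 \<le> t\<close>
        \<open>\<not> \<alpha> t \<le> xstar t\<close> lower x
      by (auto simp: ivp_lower_solution_def ivp_solution_def)
    have "s \<in> Ico_ereal t0 T" "s \<in> I"
      using s subI subJ by auto
    moreover have "(s, \<alpha> s) \<in> D"
      using lower \<open>s \<in> I\<close> by (simp add: ivp_lower_solution_def)
    ultimately obtain e y where e: "s < e" "e \<le> t" "y s = \<alpha> s"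
      and y: "\<And>u. u \<in> {s..e} \<Longrightarrow> (u, y u) \<in> D \<and> \<alpha> u \<le> y u \<and>
        (y has_real_derivative f (u, y u)) (at u within {s..e})"
      using local_solution_above_lower_solution[OF assms(1) _ assms(3) s(2) \<alpha>[OF s(1)]] by blast
    have "ivp_solution f D t0 x0 {t0..e} (\<lambda>u. if u \<le> s then xstar u else y u)"
      using y e s \<open>s \<in> Ico_ereal t0 T\<close> by (intro ivp_solution_glue[OF x]) auto
    moreover have "e \<in> Ico_ereal t0 T"
      using e s subJ by auto
    \<comment> \<open>Because \<open>s < e\<close>, the glued solution takes the value
      \<open>y e\<close> at \<open>e\<close>, while
      \<open>y e \<ge> \<alpha> e > xstar e\<close>.\<close>
    ultimately have "y e \<le> xstar e"
      using greatest[of "{t0..e}" _ e] e(1) s(1) by fastforce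
    then show False
      using y[of e] above[of e] e by auto
  qed
  \<comment> \<open>A solution satisfies both inequalities of a lower solution with equality, so
    \<open>xstar\<close> itself attains the maximum.\<close>
  moreover have "ivp_lower_solution f D t0 x0 (Ico_ereal t0 T) xstar"
    using x by (auto simp: ivp_solution_def ivp_lower_solution_def)
  ultimately show ?thesis
    by blast
qed

end
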